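(* Let $\Gamma$ be a distance-regular graph with diameter $D \geq 2$ and valency $k \geq 2$, and let $x$ be a vertex of $\Gamma$ with local graph $\Delta(x)$. (i) If the $q$-distance matrix $\mathbb{D}_q$ of $\Gamma$ has exactly one positive eigenvalue for some $q > 0$, then the smallest eigenvalue $\lambda_{\min}$ of $\Delta(x)$ satisfies $\lambda_{\min} \geq -q-1$. (ii) If the $q$-distance matrix $\mathbb{D}_q$ of $\Gamma$ has exactly one positive eigenvalue for some $q < 0$, then the second largest eigenvalue $\lambda_2$ of $\Delta(x)$ satisfies $\lambda_2 \leq -q-1$.
   Context: A connected graph $\Gamma$ of diameter $D$ is distance-regular if for all vertices $x,y$ at distance $h$ the number of vertices $z$ with $d(x,z)=i$, $d(y,z)=j$ depends only on $h,i,j$. The local graph $\Delta(x)$ is the subgraph of $\Gamma$ induced on the neighbours of $x$; its eigenvalues are those of its adjacency matrix. For real $q\ne0$, $\mathbb{D}_q$ has zero diagonal and $(\mathbb{D}_q)_{xy} = 1 + \frac{1}{q} + \cdots + \frac{1}{q^{d(x,y)-1}}$ for $x \neq y$. *)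

theory Defs
  imports "Graph_Theory.Graph_Theory" "Jordan_Normal_Form.Char_Poly"
begin

text \<open>
  A finite simple undirected graph is a \<open>graph\<close> in the sense of the graph library:
  a finite, loopless, symmetric digraph without parallel arcs, where each edge is
  represented by its two opposite arcs.
\<close>

definition vertex_dist :: "('a, 'b) pre_digraph \<Rightarrow> 'a \<Rightarrow> 'a \<Rightarrow> nat" where
  "vertex_dist G u v = (LEAST n. \<exists>p. pre_digraph.awalk G u p v \<and> length p = n)"

definition graph_diameter :: "('a, 'b) pre_digraph \<Rightarrow> nat" where
  "graph_diameter G = Max {vertex_dist G u v | u v. u \<in> verts G \<and> v \<in> verts G}"

definition distance_regular :: "('a, 'b) pre_digraph \<Rightarrow> bool" where
  "distance_regular G \<longleftrightarrow> graph G \<and> Digraph_Component.connected G \<and>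
     (\<exists>p :: nat \<Rightarrow> nat \<Rightarrow> nat \<Rightarrow> nat. \<forall>x \<in> verts G. \<forall>y \<in> verts G. \<forall>i j.
        card {z \<in> verts G. vertex_dist G x z = i \<and> vertex_dist G y z = j}
          = p (vertex_dist G x y) i j)"

definition local_graph :: "('a, 'b) pre_digraph \<Rightarrow> 'a \<Rightarrow> ('a, 'b) pre_digraph" where
  "local_graph G x = G \<restriction> {y. x \<rightarrow>\<^bsub>G\<^esub> y}"

text \<open>
  A matrix with rows and columns indexed by a finite set becomes a matrix of the library
  through an arbitrary enumeration of that set. Another enumeration conjugates it by a
  permutation matrix, so the characteristic polynomial does not depend on the choice.
\<close>

definition matrix_on :: "'a set \<Rightarrow> ('a \<Rightarrow> 'a \<Rightarrow> real) \<Rightarrow> real mat" where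
  "matrix_on S f =
     (let vs = (SOME vs. distinct vs \<and> set vs = S)
      in mat (card S) (card S) (\<lambda>(i, j). f (vs ! i) (vs ! j)))"

definition adjacency_matrix :: "('a, 'b) pre_digraph \<Rightarrow> real mat" where
  "adjacency_matrix G = matrix_on (verts G) (\<lambda>u v. if u \<rightarrow>\<^bsub>G\<^esub> v then 1 else 0)"

definition q_distance_matrix :: "('a, 'b) pre_digraph \<Rightarrow> real \<Rightarrow> real mat" where
  "q_distance_matrix G q = matrix_on (verts G)
     (\<lambda>u v. if u = v then 0 else (\<Sum>i < vertex_dist G u v. 1 / q ^ i))"

text \<open>
  Eigenvalues are counted with multiplicity throughout. Only real roots of the
  characteristic polynomial are collected, which loses nothing for the symmetric matrices
  considered here.
\<close>

definition eigenvalues_mset :: "real mat \<Rightarrow> real multiset" where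
  "eigenvalues_mset A = proots (char_poly A)"

definition exactly_one_positive_eigenvalue :: "real mat \<Rightarrow> bool" where
  "exactly_one_positive_eigenvalue A \<longleftrightarrow> size {# t \<in># eigenvalues_mset A. t > 0 #} = 1"

definition smallest_eigenvalue :: "real mat \<Rightarrow> real" where
  "smallest_eigenvalue A = Min (set_mset (eigenvalues_mset A))"

definition second_largest_eigenvalue :: "real mat \<Rightarrow> real" where
  "second_largest_eigenvalue A = rev (sorted_list_of_multiset (eigenvalues_mset A)) ! 1"

end

theory Submission
  imports Defs "Jordan_Normal_Form.Schur_Decomposition"
begin

text \<open>
  The rows and columns of \<open>D\<^sub>q\<close> belonging to the neighbours of \<open>x\<close> form the matrix
  \<open>M = (1 + 1/q) (J - I) - (1/q) A\<close>, where \<open>A\<close> is the adjacency matrix of the local graph; the row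
  of \<open>x\<close> is \<open>1\<close> on all neighbours and \<open>0\<close> at \<open>x\<close>. If some \<open>v\<close> orthogonal to the all-ones
  vector \<open>1\<close> had \<open>v\<^sup>T M v > 0\<close>, then \<open>v\<close> and \<open>t e\<^sub>x + 1\<close> for large \<open>t\<close> would span a plane on which
  \<open>D\<^sub>q\<close> is positive definite, giving two positive eigenvalues. Hence
  \<open>v\<^sup>T A v / q \<ge> - (1 + 1/q) |v|\<^sup>2\<close> whenever \<open>v\<close> is orthogonal to \<open>1\<close>. For \<open>q < 0\<close> this bounds
  the second largest eigenvalue by Courant-Fischer. For \<open>q > 0\<close> it bounds every eigenvalue with an
  eigenvector orthogonal to \<open>1\<close>; as the local graph is regular, the only other eigenvalue is its
  valency, which is nonnegative.
\<close>

section \<open>Spectral theorem for real symmetric matrices\<close>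

text \<open>Over the complex numbers the characteristic polynomial splits, which gives an eigenpair
  \<open>l\<close>, \<open>z\<close>. As \<open>A\<close> is real, \<open>conjugate z\<close> is an
  eigenvector for \<open>conjugate l\<close>; moving the symmetric matrix across the product of
  \<open>conjugate z\<close> and \<open>z\<close>, which is nonzero, forces \<open>l\<close> to be
  real.\<close>

lemma symmetric_real_has_eigenvalue:
  fixes A :: "real mat"
  assumes A: "A \<in> carrier_mat n n" and sym: "A\<^sup>T = A" and n: "n > 0"
  shows "\<exists>e. eigenvalue A e"
proof -
  let ?B = "map_mat complex_of_real A"
  have B: "?B \<in> carrier_mat n n" using A by simp
  obtain as where as: "char_poly ?B = (\<Prod>a\<leftarrow>as. [:- a, 1:])" "length as = n"
    using char_poly_factorized[OF B] by blast
  define l where "l = hd as"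
  have "l \<in> set as" using as(2) n unfolding l_def by (cases as) auto
  hence root: "poly (char_poly ?B) l = 0"
    unfolding as(1) by (auto simp: poly_prod_list prod_list_zero_iff image_iff)
  hence "eigenvalue ?B l" using eigenvalue_root_char_poly[OF B] by simp
  then obtain z where z: "z \<in> carrier_vec n" "z \<noteq> 0\<^sub>v n" and Bz: "?B *\<^sub>v z = l \<cdot>\<^sub>v z"
    unfolding eigenvalue_def eigenvector_def using B by auto
  have cz: "conjugate z \<in> carrier_vec n" using z by simp
  have symB: "?B\<^sup>T = ?B" using sym by (simp add: map_mat_transpose)
  have "?B *\<^sub>v conjugate z = conjugate (?B *\<^sub>v z)"
    using A z by (intro eq_vecI) (auto simp: scalar_prod_def)
  also have "\<dots> = conjugate l \<cdot>\<^sub>v conjugate z" unfolding Bz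
    using z by (intro eq_vecI) auto
  finally have Bcz: "?B *\<^sub>v conjugate z = conjugate l \<cdot>\<^sub>v conjugate z" .
  have "(?B\<^sup>T *\<^sub>v conjugate z) \<bullet> z = conjugate z \<bullet> (?B *\<^sub>v z)"
    using transpose_vec_mult_scalar[OF B z(1) cz] .
  hence "conjugate l * (conjugate z \<bullet> z) = l * (conjugate z \<bullet> z)"
    unfolding symB Bcz Bz using z cz by simp
  moreover have "conjugate z \<bullet> z \<noteq> 0"
    using conjugate_square_eq_0_vec[OF z(1)] z comm_scalar_prod[OF cz z(1)] by simp
  ultimately have "cnj l = l" by simp
  hence "l \<in> \<real>" by (metis Reals_cnj_iff)
  then obtain e where e: "l = of_real e" by (auto elim: Reals_cases)
  have "poly (char_poly A) e = 0"
    using root unfolding e of_real_hom.char_poly_hom[OF A] by simp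
  thus ?thesis using eigenvalue_root_char_poly[OF A] by auto
qed

text \<open>Complete \<open>v\<close> to a basis, orthogonalise and normalise. Gram-Schmidt keeps
  the first vector and normalising only rescales it, so column 0 is a multiple of \<open>v\<close>.
  This is the change of basis that splits off an eigenvector.\<close>

lemma orthogonal_matrix_with_first_column:
  fixes v :: "real vec"
  assumes v: "v \<in> carrier_vec n" and v0: "v \<noteq> 0\<^sub>v n"
  shows "\<exists>W \<in> carrier_mat n n. \<exists>c. W\<^sup>T * W = 1\<^sub>m n \<and> col W 0 = c \<cdot>\<^sub>v v"
proof -
  interpret cof_vec_space n "TYPE(real)" .
  define b where "b = basis_completion v"
  define ws where "ws = gram_schmidt n b"
  from basis_completion[OF v v0, folded b_def]
  have dist: "distinct b" and indep: "\<not> lin_dep (set b)" and b: "set b \<subseteq> carrier_vec n"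
    and hdb: "hd b = v" and len: "length b = n" by auto
  have n: "n > 0" using v v0 by (cases n) auto
  obtain vs where bv: "b = v # vs" using hdb len n by (cases b) auto
  from gram_schmidt_result[OF b dist indep refl, folded ws_def]
  have ws: "set ws \<subseteq> carrier_vec n" "corthogonal ws" "length ws = n"
    by (auto simp: len)
  have ws0: "ws ! 0 = v"
    using gram_schmidt_hd[OF v, of vs, folded bv, folded ws_def] ws(3) n
    by (metis hd_conv_nth length_0_conv less_numeral_extra(3))
  have wsc: "i < n \<Longrightarrow> ws ! i \<in> carrier_vec n" for i using ws nth_mem by auto
  have orth: "ws ! i \<bullet> ws ! j = 0 \<longleftrightarrow> i \<noteq> j" if "i < n" "j < n" for i j
    using ws(2) that unfolding corthogonal_def ws(3) by auto
  define s where "s i = 1 / sqrt (ws ! i \<bullet> ws ! i)" for i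
  define W where "W = mat_of_cols n (map (\<lambda>i. s i \<cdot>\<^sub>v ws ! i) [0..<n])"
  have W: "W \<in> carrier_mat n n" 
    unfolding W_def using mat_of_cols_carrier(1)[of n "map (\<lambda>i. s i \<cdot>\<^sub>v ws ! i) [0..<n]"] by simp
  have colW: "col W i = s i \<cdot>\<^sub>v ws ! i" if "i < n" for i
    unfolding W_def using that wsc[OF that] by (subst col_mat_of_cols) auto
  have "W\<^sup>T * W = 1\<^sub>m n"
  proof (rule eq_matI)
    fix i j assume "i < dim_row (1\<^sub>m n :: real mat)" "j < dim_col (1\<^sub>m n :: real mat)"
    hence i: "i < n" and j: "j < n" by auto
    have "(W\<^sup>T * W) $$ (i, j) = col W i \<bullet> col W j" using W i j by simp
    also have "\<dots> = s i * s j * (ws ! i \<bullet> ws ! j)"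
      unfolding colW[OF i] colW[OF j] using wsc[OF i] wsc[OF j] by simp
    also have "\<dots> = (if i = j then 1 else 0)"
    proof (cases "i = j")
      case True
      have "ws ! i \<bullet> ws ! i \<noteq> 0" "ws ! i \<bullet> ws ! i \<ge> 0"
        using orth[OF i i] by (auto simp: scalar_prod_def intro!: sum_nonneg)
      thus ?thesis using True unfolding s_def by (simp add: field_simps)
    qed (use orth[OF i j] in auto)
    finally show "(W\<^sup>T * W) $$ (i, j) = 1\<^sub>m n $$ (i, j)" using i j by simp
  qed (use W in auto)
  moreover have "col W 0 = s 0 \<cdot>\<^sub>v v" using colW[OF n] ws0 by simp
  ultimately show ?thesis using W by blast
qed

text \<open>Deflation: in an orthonormal basis that starts with an eigenvector, a symmetric matrix
  splits into a 1 by 1 block and a smaller symmetric block, to which the induction hypothesis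
  applies.\<close>

theorem real_spectral_theorem:
  fixes A :: "real mat"
  assumes "A \<in> carrier_mat n n" and "A\<^sup>T = A"
  shows "\<exists>Q \<in> carrier_mat n n. \<exists>d. Q\<^sup>T * Q = 1\<^sub>m n \<and> Q\<^sup>T * A * Q = mat_diag n d"
  using assms
proof (induction n arbitrary: A)
  case 0
  thus ?case by (intro bexI[of _ "1\<^sub>m 0"] exI[of _ "\<lambda>_. 0"]) (auto simp: mat_diag_def intro!: eq_matI)
next
  case (Suc n A)
  note A = Suc.prems(1)
  obtain e v where v: "v \<in> carrier_vec (Suc n)" "v \<noteq> 0\<^sub>v (Suc n)" "A *\<^sub>v v = e \<cdot>\<^sub>v v"
    using symmetric_real_has_eigenvalue[OF Suc.prems] A
    unfolding eigenvalue_def eigenvector_def by auto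
  obtain W c where W: "W \<in> carrier_mat (Suc n) (Suc n)" and WW: "W\<^sup>T * W = 1\<^sub>m (Suc n)"
    and col0: "col W 0 = c \<cdot>\<^sub>v v"
    using orthogonal_matrix_with_first_column[OF v(1,2)] by blast
  have A_col0: "A *\<^sub>v col W 0 = e \<cdot>\<^sub>v col W 0"
    unfolding col0 using A v by (simp add: mult_mat_vec[OF A v(1)] smult_smult_assoc mult.commute)
  define A' where "A' = W\<^sup>T * A * W"
  have A': "A' \<in> carrier_mat (Suc n) (Suc n)" unfolding A'_def using W A by simp
  have symA': "A'\<^sup>T = A'"
  proof -
    have "A'\<^sup>T = W\<^sup>T * (W\<^sup>T * A)\<^sup>T" unfolding A'_def
      by (rule transpose_mult) (use W A in auto)
    also have "(W\<^sup>T * A)\<^sup>T = A\<^sup>T * W" 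
      using transpose_mult[of "W\<^sup>T" "Suc n" "Suc n" A "Suc n"] W A by simp
    finally show ?thesis unfolding A'_def Suc.prems(2)
      using W A by (simp add: assoc_mult_mat[of _ "Suc n" "Suc n" _ "Suc n" _ "Suc n"])
  qed
  \<comment> \<open>Column 0 of \<open>W\<close> is an eigenvector, so this entry is
    \<open>e\<close> times the inner product of columns \<open>i\<close> and 0. Row 0 then follows
    from the symmetry of \<open>A'\<close>.\<close>
  have first: "A' $$ (i, 0) = (if i = 0 then e else 0)" if i: "i < Suc n" for i
  proof -
    have "A' $$ (i, 0) = (W\<^sup>T * (A * W)) $$ (i, 0)"
      unfolding A'_def using W A by (simp add: assoc_mult_mat[of _ "Suc n" "Suc n" _ "Suc n" _ "Suc n"])
    also have "\<dots> = col W i \<bullet> (A *\<^sub>v col W 0)" using W A i by (simp add: mult_mat_vec_def)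
    also have "\<dots> = e * (col W i \<bullet> col W 0)" unfolding A_col0 using W i by simp
    also have "col W i \<bullet> col W 0 = (W\<^sup>T * W) $$ (i, 0)" using W i by simp
    finally show ?thesis unfolding WW using i by simp
  qed
  define A3 where "A3 = mat n n (\<lambda>(i, j). A' $$ (Suc i, Suc j))"
  have A3: "A3 \<in> carrier_mat n n" unfolding A3_def by simp
  have sym: "A' $$ (i, j) = A' $$ (j, i)" if "i < Suc n" "j < Suc n" for i j
    using symA' that A' by (metis carrier_matD index_transpose_mat(1))
  have "A3\<^sup>T = A3" unfolding A3_def by (rule eq_matI) (auto simp: sym)
  from Suc.IH[OF A3 this] obtain P d where P: "P \<in> carrier_mat n n"
    and PP: "P\<^sup>T * P = 1\<^sub>m n" and PA: "P\<^sup>T * A3 * P = mat_diag n d" by blast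
  define E where "E = mat 1 1 (\<lambda>_. e)"
  have E: "E \<in> carrier_mat 1 1" unfolding E_def by simp
  have block: "A' = four_block_mat E (0\<^sub>m 1 n) (0\<^sub>m n 1) A3"
  proof (rule eq_matI)
    fix i j assume "i < dim_row (four_block_mat E (0\<^sub>m 1 n) (0\<^sub>m n 1) A3)"
      "j < dim_col (four_block_mat E (0\<^sub>m 1 n) (0\<^sub>m n 1) A3)"
    hence ij: "i < Suc n" "j < Suc n" using A3 E by auto
    show "A' $$ (i, j) = four_block_mat E (0\<^sub>m 1 n) (0\<^sub>m n 1) A3 $$ (i, j)"
      using ij E A3 first sym[of 0 j] by (cases i; cases j) (auto simp: A3_def E_def)
  qed (use A' A3 E in auto)
  \<comment> \<open>\<open>R\<close> leaves the split-off eigenvector fixed and diagonalises the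
    remaining block; the orthogonal matrix sought is \<open>W * R\<close>.\<close>
  define R where "R = four_block_mat (1\<^sub>m 1) (0\<^sub>m 1 n) (0\<^sub>m n 1) P"
  have R: "R \<in> carrier_mat (Suc n) (Suc n)"
    unfolding R_def using four_block_carrier_mat[of "1\<^sub>m 1" 1 1 P n n] P by simp
  have RT: "R\<^sup>T = four_block_mat (1\<^sub>m 1) (0\<^sub>m 1 n) (0\<^sub>m n 1) P\<^sup>T"
    unfolding R_def using P by (subst transpose_four_block_mat) auto
  note mult_block = mult_four_block_mat[where ?nr1.0=1 and ?n1.0=1 and ?nr2.0=n and ?n2.0=n
      and ?nc1.0=1 and ?nc2.0=n]
  have RR: "R\<^sup>T * R = 1\<^sub>m (Suc n)"
    unfolding RT unfolding R_def using P PP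
    by (subst mult_block) auto
  have "R\<^sup>T * A' * R = four_block_mat E (0\<^sub>m 1 n) (0\<^sub>m n 1) (P\<^sup>T * A3 * P)"
    unfolding RT block unfolding R_def using P A3 E
    by (subst mult_block, auto, subst mult_block, auto)
  also have "\<dots> = mat_diag (Suc n) (case_nat e d)"
    unfolding PA by (rule eq_matI) (auto simp: mat_diag_def E_def split: nat.splits)
  finally have RA: "R\<^sup>T * A' * R = mat_diag (Suc n) (case_nat e d)" .
  let ?N = "Suc n"
  note assoc = assoc_mult_mat[of _ ?N ?N _ ?N _ ?N]
  have T: "(W * R)\<^sup>T = R\<^sup>T * W\<^sup>T" by (rule transpose_mult[OF W R])
  have "(W * R)\<^sup>T * (W * R) = R\<^sup>T * (W\<^sup>T * W) * R" unfolding T using W R by (simp add: assoc)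
  hence 1: "(W * R)\<^sup>T * (W * R) = 1\<^sub>m ?N" unfolding WW using R RR by simp
  have "(W * R)\<^sup>T * A * (W * R) = R\<^sup>T * A' * R" unfolding T A'_def using W R A by (simp add: assoc)
  hence 2: "(W * R)\<^sup>T * A * (W * R) = mat_diag ?N (case_nat e d)" unfolding RA .
  show ?case using 1 2 W R by (intro bexI[of _ "W * R"] exI conjI) auto
qed

section \<open>Eigenvalues of matrices indexed by a finite set\<close>

lemma some_enumeration:
  assumes "finite S"
  shows "distinct (SOME vs. distinct vs \<and> set vs = S)" "set (SOME vs. distinct vs \<and> set vs = S) = S"
proof -
  have "\<exists>vs. distinct vs \<and> set vs = S" using finite_distinct_list[OF assms] by blast
  from someI_ex[OF this] show "distinct (SOME vs. distinct vs \<and> set vs = S)"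
    "set (SOME vs. distinct vs \<and> set vs = S) = S" by simp_all
qed

lemma proots_prod_linear: "proots (\<Prod>a\<leftarrow>xs. [:- a, 1:]) = mset (xs :: real list)"
proof (induction xs)
  case (Cons a xs)
  have "(\<Prod>a\<leftarrow>xs. [:- a, 1:]) \<noteq> 0" by (auto simp: prod_list_zero_iff)
  thus ?case using Cons by (simp add: proots_mult del: mult_pCons_left)
qed simp

text \<open>The spectral theorem freed from the enumeration: \<open>w i\<close> is the
  \<open>i\<close>-th eigenvector as a function on \<open>S\<close> and \<open>d i\<close> its
  eigenvalue. The columns of the orthogonal matrix give orthonormality, its rows give completeness,
  and the last equation is the spectral expansion of \<open>f\<close>.\<close>

lemma matrix_on_spectral_decomposition:
  fixes f :: "'a \<Rightarrow> 'a \<Rightarrow> real"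
  assumes S: "finite S" and sym: "\<And>a b. a \<in> S \<Longrightarrow> b \<in> S \<Longrightarrow> f a b = f b a"
  obtains d :: "nat \<Rightarrow> real" and w :: "nat \<Rightarrow> 'a \<Rightarrow> real" where
    "eigenvalues_mset (matrix_on S f) = image_mset d (mset_set {..<card S})"
    "\<And>i j. i < card S \<Longrightarrow> j < card S \<Longrightarrow> (\<Sum>a\<in>S. w i a * w j a) = (if i = j then 1 else 0)"
    "\<And>a b. a \<in> S \<Longrightarrow> b \<in> S \<Longrightarrow> (\<Sum>i<card S. w i a * w i b) = (if a = b then 1 else 0)"
    "\<And>a b. a \<in> S \<Longrightarrow> b \<in> S \<Longrightarrow> f a b = (\<Sum>i<card S. d i * (w i a * w i b))"
proof -
  let ?n = "card S"
  define vs where "vs = (SOME vs. distinct vs \<and> set vs = S)"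
  note vs = some_enumeration[OF S, folded vs_def]
  have len: "length vs = ?n" using distinct_card[OF vs(1)] vs(2) by simp
  have bij: "bij_betw (nth vs) {..<?n} S"
    by (rule bij_betw_nth[OF vs(1)]) (simp_all add: len vs(2))
  define M where "M = matrix_on S f"
  have M: "M = mat ?n ?n (\<lambda>(i, j). f (vs ! i) (vs ! j))"
    unfolding M_def matrix_on_def vs_def[symmetric] Let_def ..
  have Mc: "M \<in> carrier_mat ?n ?n" unfolding M by simp
  have inS: "vs ! i \<in> S" if "i < ?n" for i using that bij by (auto dest: bij_betwE)
  have "M\<^sup>T = M" unfolding M by (rule eq_matI) (auto intro!: sym inS)
  from real_spectral_theorem[OF Mc this] obtain Q d where Q: "Q \<in> carrier_mat ?n ?n"
    and QQ: "Q\<^sup>T * Q = 1\<^sub>m ?n" and D: "Q\<^sup>T * M * Q = mat_diag ?n d" by blast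
  have QT: "Q\<^sup>T \<in> carrier_mat ?n ?n" using Q by simp
  have QQ': "Q * Q\<^sup>T = 1\<^sub>m ?n" by (rule mat_mult_left_right_inverse[OF QT Q QQ])
  note assoc = assoc_mult_mat[of _ ?n ?n _ ?n _ ?n]
  have "Q * mat_diag ?n d * Q\<^sup>T = (Q * Q\<^sup>T) * M * (Q * Q\<^sup>T)"
    unfolding D[symmetric] using Q Mc by (simp add: assoc)
  hence M_eq: "M = Q * mat_diag ?n d * Q\<^sup>T" unfolding QQ' using Mc by simp
  \<comment> \<open>Similar matrices have equal characteristic polynomials, so \<open>d\<close>
    lists the eigenvalues with their multiplicities.\<close>
  have "similar_mat_wit M (mat_diag ?n d) Q Q\<^sup>T"
    by (rule similar_mat_witI[OF QQ' QQ M_eq Mc _ Q QT]) simp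
  hence "char_poly M = char_poly (mat_diag ?n d)"
    by (intro char_poly_similar) (auto simp: similar_mat_def)
  also have "\<dots> = (\<Prod>a\<leftarrow>diag_mat (mat_diag ?n d). [:- a, 1:])"
    by (rule char_poly_upper_triangular[of _ ?n]) (auto simp: mat_diag_def)
  also have "diag_mat (mat_diag ?n d) = map d [0..<?n]"
    by (auto simp: diag_mat_def mat_diag_def intro!: nth_equalityI)
  finally have cp: "char_poly M = (\<Prod>a\<leftarrow>map d [0..<?n]. [:- a, 1:])" .
  have "proots (char_poly M) = mset (map d [0..<?n])"
    unfolding cp by (rule proots_prod_linear)
  also have "\<dots> = image_mset d (mset_set {..<?n})"
    by (simp add: mset_upt atLeast0LessThan)
  finally have mset: "eigenvalues_mset (matrix_on S f) = image_mset d (mset_set {..<?n})"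
    unfolding eigenvalues_mset_def M_def .
  \<comment> \<open>The position of an element of \<open>S\<close> in the chosen
    enumeration.\<close>
  define ix where "ix = the_inv_into {..<?n} (nth vs)"
  have ix: "ix (vs ! i) = i" if "i < ?n" for i
    unfolding ix_def using that bij by (intro the_inv_into_f_f) (auto simp: bij_betw_def)
  have ixS: "ix a < ?n" "vs ! (ix a) = a" if "a \<in> S" for a
  proof -
    have "a \<in> (!) vs ` {..<?n}" using that unfolding bij_betw_imp_surj_on[OF bij] .
    then obtain i where "i < ?n" "a = vs ! i" by (auto elim: imageE)
    thus "ix a < ?n" "vs ! (ix a) = a" using ix by simp_all
  qed
  define w where "w i a = Q $$ (ix a, i)" for i a
  show thesis
  proof
    show "eigenvalues_mset (matrix_on S f) = image_mset d (mset_set {..<?n})" by (rule mset)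
    fix i j assume ij: "i < ?n" "j < ?n"
    have "(\<Sum>a\<in>S. w i a * w j a) = (\<Sum>k<?n. w i (vs ! k) * w j (vs ! k))"
      using sum.reindex_bij_betw[OF bij, of "\<lambda>a. w i a * w j a"] by simp
    also have "\<dots> = (Q\<^sup>T * Q) $$ (i, j)"
      using Q ij by (auto simp: w_def ix scalar_prod_def atLeast0LessThan intro!: sum.cong)
    finally show "(\<Sum>a\<in>S. w i a * w j a) = (if i = j then 1 else 0)" using ij unfolding QQ by simp
  next
    fix a b assume ab: "a \<in> S" "b \<in> S"
    note ixab = ixS[OF ab(1)] ixS[OF ab(2)]
    have "(\<Sum>i<?n. w i a * w i b) = (Q * Q\<^sup>T) $$ (ix a, ix b)"
      using Q ixab by (auto simp: w_def scalar_prod_def atLeast0LessThan intro!: sum.cong)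
    also have "\<dots> = (if ix a = ix b then 1 else 0)" unfolding QQ' using ixab by simp
    also have "ix a = ix b \<longleftrightarrow> a = b" using ixab by metis
    finally show "(\<Sum>i<?n. w i a * w i b) = (if a = b then 1 else 0)" .
    have "f a b = M $$ (ix a, ix b)" unfolding M using ixab by simp
    also have "\<dots> = (\<Sum>i<?n. d i * (w i a * w i b))"
      unfolding M_eq mat_diag_mult_right[OF Q] using Q ixab
      by (auto simp: w_def scalar_prod_def atLeast0LessThan intro!: sum.cong)
    finally show "f a b = (\<Sum>i<?n. d i * (w i a * w i b))" .
  qed
qed

section \<open>Quadratic forms and variational bounds on eigenvalues\<close>

definition quadratic_form :: "'a set \<Rightarrow> ('a \<Rightarrow> 'a \<Rightarrow> real) \<Rightarrow> ('a \<Rightarrow> real) \<Rightarrow> real" where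
  "quadratic_form S f g = (\<Sum>a\<in>S. \<Sum>b\<in>S. g a * f a b * g b)"

text \<open>In coordinates with respect to the \<open>w i\<close> the form is a weighted sum of
  squares. Applied to the identity matrix with all weights 1 it gives Parseval's identity.\<close>

lemma quadratic_form_diagonal:
  assumes "\<And>a b. a \<in> S \<Longrightarrow> b \<in> S \<Longrightarrow> f a b = (\<Sum>i\<in>I. d i * (w i a * w i b))"
  shows "quadratic_form S f g = (\<Sum>i\<in>I. d i * (\<Sum>a\<in>S. w i a * g a)\<^sup>2)"
proof -
  have "quadratic_form S f g = (\<Sum>a\<in>S. \<Sum>b\<in>S. \<Sum>i\<in>I. d i * (w i a * g a * (w i b * g b)))"
    unfolding quadratic_form_def
    by (intro sum.cong refl) (simp add: assms sum_distrib_left sum_distrib_right algebra_simps)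
  also have "\<dots> = (\<Sum>a\<in>S. \<Sum>i\<in>I. \<Sum>b\<in>S. d i * (w i a * g a * (w i b * g b)))"
    by (intro sum.cong refl sum.swap)
  also have "\<dots> = (\<Sum>i\<in>I. \<Sum>a\<in>S. \<Sum>b\<in>S. d i * (w i a * g a * (w i b * g b)))"
    by (rule sum.swap)
  also have "\<dots> = (\<Sum>i\<in>I. d i * (\<Sum>a\<in>S. w i a * g a)\<^sup>2)"
    by (simp add: power2_eq_square sum_product flip: sum_distrib_left)
  finally show ?thesis .
qed

lemma quadratic_form_identity:
  assumes "finite S"
  shows "quadratic_form S (\<lambda>a b. if a = b then 1 else 0) g = (\<Sum>a\<in>S. (g a)\<^sup>2)"
proof -
  have "(\<Sum>b\<in>S. g a * (if a = b then 1 else 0) * g b) = (g a)\<^sup>2" if "a \<in> S" for a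
  proof -
    have "(\<Sum>b\<in>S. g a * (if a = b then 1 else 0) * g b) = (\<Sum>b\<in>S. if a = b then g a * g b else 0)"
      by (intro sum.cong) auto
    thus ?thesis using assms that by (simp add: power2_eq_square)
  qed
  thus ?thesis unfolding quadratic_form_def by simp
qed

lemma size_filter_image_mset_set:
  assumes "finite I"
  shows "size {#t \<in># image_mset d (mset_set I). P t#} = card {i \<in> I. P (d i)}"
  using assms by (simp add: filter_mset_image_mset filter_mset_mset_set)

text \<open>Take for \<open>u\<close> the eigenvector of the single eigenvalue above
  \<open>c\<close>: orthogonally to it, only eigenvalues at most \<open>c\<close> contribute to the
  form. With \<open>c = 0\<close> this turns the count of positive eigenvalues into a statement
  about the form.\<close>

lemma at_most_one_large_eigenvalue_imp_bound_on_hyperplane: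
  assumes S: "finite S" and sym: "\<And>a b. a \<in> S \<Longrightarrow> b \<in> S \<Longrightarrow> f a b = f b a"
    and one: "size {#t \<in># eigenvalues_mset (matrix_on S f). t > c#} \<le> 1"
  shows "\<exists>u. \<forall>g. (\<Sum>a\<in>S. u a * g a) = 0 \<longrightarrow> quadratic_form S f g \<le> c * (\<Sum>a\<in>S. (g a)\<^sup>2)"
proof -
  let ?n = "card S"
  obtain d w where d: "eigenvalues_mset (matrix_on S f) = image_mset d (mset_set {..<?n})"
    and ort': "\<And>i j. i < ?n \<Longrightarrow> j < ?n \<Longrightarrow> (\<Sum>a\<in>S. w i a * w j a) = (if i = j then 1 else 0)"
    and ort: "\<And>a b. a \<in> S \<Longrightarrow> b \<in> S \<Longrightarrow> (\<Sum>i<?n. w i a * w i b) = (if a = b then 1 else 0)"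
    and f: "\<And>a b. a \<in> S \<Longrightarrow> b \<in> S \<Longrightarrow> f a b = (\<Sum>i<?n. d i * (w i a * w i b))"
    by (rule matrix_on_spectral_decomposition[of S f, OF S sym], assumption, assumption) (rule that)
  let ?I = "{i \<in> {..<?n}. d i > c}"
  \<comment> \<open>If no \<open>d i\<close> exceeds \<open>c\<close>, this is an arbitrary number,
    which does no harm: every term then satisfies the bound already.\<close>
  define j where "j = (SOME j. j \<in> ?I)"
  have j: "i = j" if "i < ?n" "d i > c" for i
  proof -
    have "card ?I \<le> Suc 0" using one unfolding d by (simp add: size_filter_image_mset_set)
    hence eq: "\<forall>a\<in>?I. \<forall>b\<in>?I. a = b" by (subst (asm) card_le_Suc0_iff_eq) simp_all
    have i: "i \<in> ?I" using that by simp
    hence "j \<in> ?I" unfolding j_def by (rule someI)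
    thus ?thesis using eq i by blast
  qed
  show ?thesis
  proof (intro exI allI impI)
    fix g assume g: "(\<Sum>a\<in>S. w j a * g a) = 0"
    have "quadratic_form S f g = (\<Sum>i<?n. d i * (\<Sum>a\<in>S. w i a * g a)\<^sup>2)"
      by (rule quadratic_form_diagonal) (rule f)
    also have "\<dots> \<le> (\<Sum>i<?n. c * (\<Sum>a\<in>S. w i a * g a)\<^sup>2)"
    proof (rule sum_mono)
      fix i assume "i \<in> {..<?n}"
      thus "d i * (\<Sum>a\<in>S. w i a * g a)\<^sup>2 \<le> c * (\<Sum>a\<in>S. w i a * g a)\<^sup>2"
        using j[of i] g by (cases "d i > c") (auto intro: mult_right_mono)
    qed
    also have "\<dots> = c * quadratic_form S (\<lambda>a b. if a = b then 1 else 0) g"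
      by (subst quadratic_form_diagonal[where I="{..<?n}" and d="\<lambda>_. 1" and w=w])
        (simp_all add: ort sum_distrib_left)
    finally show "quadratic_form S f g \<le> c * (\<Sum>a\<in>S. (g a)\<^sup>2)"
      unfolding quadratic_form_identity[OF S] .
  qed
qed

text \<open>One half of Courant-Fischer: if two eigenvalues exceeded \<open>c\<close>, the plane of
  their eigenvectors would meet the hyperplane in a nonzero \<open>g\<close>, and there the form
  would exceed \<open>c\<close> times the squared norm.\<close>

lemma bound_on_hyperplane_imp_second_largest_eigenvalue_le:
  assumes S: "finite S" and sym: "\<And>a b. a \<in> S \<Longrightarrow> b \<in> S \<Longrightarrow> f a b = f b a"
    and card: "card S \<ge> 2"
    and bound: "\<And>g. (\<Sum>a\<in>S. u a * g a) = 0 \<Longrightarrow> quadratic_form S f g \<le> c * (\<Sum>a\<in>S. (g a)\<^sup>2)"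
  shows "second_largest_eigenvalue (matrix_on S f) \<le> c"
proof (rule ccontr)
  let ?n = "card S"
  assume "\<not> ?thesis"
  hence gt: "second_largest_eigenvalue (matrix_on S f) > c" by simp
  obtain d w where d: "eigenvalues_mset (matrix_on S f) = image_mset d (mset_set {..<?n})"
    and ort': "\<And>i j. i < ?n \<Longrightarrow> j < ?n \<Longrightarrow> (\<Sum>a\<in>S. w i a * w j a) = (if i = j then 1 else 0)"
    and ort: "\<And>a b. a \<in> S \<Longrightarrow> b \<in> S \<Longrightarrow> (\<Sum>i<?n. w i a * w i b) = (if a = b then 1 else 0)"
    and f: "\<And>a b. a \<in> S \<Longrightarrow> b \<in> S \<Longrightarrow> f a b = (\<Sum>i<?n. d i * (w i a * w i b))"
    by (rule matrix_on_spectral_decomposition[of S f, OF S sym], assumption, assumption) (rule that)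
  define xs where "xs = sorted_list_of_multiset (eigenvalues_mset (matrix_on S f))"
  have xs: "mset xs = image_mset d (mset_set {..<?n})" "sorted xs"
    unfolding xs_def d by simp_all
  have "length xs = ?n" using arg_cong[OF xs(1), of size] by simp
  then obtain a b ys where rev: "rev xs = a # b # ys"
    using card by (metis Suc_le_length_iff length_rev numeral_2_eq_2)
  have "b > c" using gt rev unfolding second_largest_eigenvalue_def xs_def by simp
  moreover have "a \<ge> b"
  proof -
    have "xs = rev ys @ [b, a]" using arg_cong[OF rev, of List.rev] by simp
    thus ?thesis using xs(2) by (simp add: sorted_append)
  qed
  \<comment> \<open>Counting with multiplicity yields two distinct indices \<open>i\<close> and
    \<open>j\<close> even when the eigenvalues \<open>a\<close> and \<open>b\<close>
    coincide.\<close>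
  ultimately have "size {#t \<in># mset (rev xs). t > c#} \<ge> 2" unfolding rev by simp
  hence "card {i \<in> {..<?n}. d i > c} \<ge> 2" using xs(1) by (simp add: size_filter_image_mset_set)
  then obtain i j where ij: "i < ?n" "j < ?n" "i \<noteq> j" "d i > c" "d j > c"
    using card_le_Suc0_iff_eq[of "{i \<in> {..<?n}. d i > c}"] by auto
  define U where "U k = (\<Sum>a\<in>S. u a * w k a)" for k
  \<comment> \<open>A nonzero solution of one linear equation in two unknowns; it makes
    \<open>g\<close> orthogonal to \<open>u\<close>.\<close>
  obtain p r where pr: "p * U i + r * U j = 0" "p \<noteq> 0 \<or> r \<noteq> 0"
  proof (cases "U j = 0")
    case True
    thus ?thesis using that[of 0 1] by simp
  next
    case False
    thus ?thesis using that[of "U j" "- U i"] by simp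
  qed
  define g where "g a = p * w i a + r * w j a" for a
  have "(\<Sum>a\<in>S. u a * g a) = p * U i + r * U j"
    unfolding g_def U_def by (simp add: algebra_simps sum.distrib sum_distrib_left)
  hence le: "quadratic_form S f g \<le> c * (\<Sum>a\<in>S. (g a)\<^sup>2)" using pr by (intro bound) simp
  have wg: "(\<Sum>a\<in>S. w k a * g a) = (if k = i then p else if k = j then r else 0)" if "k < ?n" for k
  proof -
    have "(\<Sum>a\<in>S. w k a * g a) = p * (\<Sum>a\<in>S. w k a * w i a) + r * (\<Sum>a\<in>S. w k a * w j a)"
      unfolding g_def by (simp add: algebra_simps sum.distrib sum_distrib_left)
    thus ?thesis using ij that by (simp add: ort')
  qed
  have two: "(\<Sum>k<?n. e k * (\<Sum>a\<in>S. w k a * g a)\<^sup>2) = e i * p\<^sup>2 + e j * r\<^sup>2" for e :: "nat \<Rightarrow> real"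
  proof -
    have "(\<Sum>k<?n. e k * (\<Sum>a\<in>S. w k a * g a)\<^sup>2) = (\<Sum>k<?n. (if k = i then e k * p\<^sup>2 else 0) + (if k = j then e k * r\<^sup>2 else 0))"
      using ij by (intro sum.cong) (auto simp: wg)
    thus ?thesis using ij by (simp add: sum.distrib)
  qed
  have 1: "quadratic_form S f g = d i * p\<^sup>2 + d j * r\<^sup>2"
    unfolding two[symmetric] by (rule quadratic_form_diagonal) (rule f)
  have "quadratic_form S (\<lambda>a b. if a = b then 1 else 0) g = 1 * p\<^sup>2 + 1 * r\<^sup>2"
    unfolding two[of "\<lambda>_. 1", symmetric]
    by (rule quadratic_form_diagonal) (simp add: ort)
  hence 2: "(\<Sum>a\<in>S. (g a)\<^sup>2) = p\<^sup>2 + r\<^sup>2" by (simp add: quadratic_form_identity[OF S])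
  have "(d i - c) * p\<^sup>2 + (d j - c) * r\<^sup>2 \<le> 0" using le unfolding 1 2 by (simp add: algebra_simps)
  moreover have "(d i - c) * p\<^sup>2 \<ge> 0" "(d j - c) * r\<^sup>2 \<ge> 0" using ij by auto
  ultimately have "(d i - c) * p\<^sup>2 = 0" "(d j - c) * r\<^sup>2 = 0" by linarith+
  thus False using ij pr by auto
qed

text \<open>Every member of the multiset is some \<open>d j\<close>, and the unit vector
  \<open>w j\<close> is a real eigenvector for it, so it suffices to bound \<open>t\<close> over
  real eigenpairs.\<close>

lemma smallest_eigenvalue_geI:
  assumes S: "finite S" "S \<noteq> {}" and sym: "\<And>a b. a \<in> S \<Longrightarrow> b \<in> S \<Longrightarrow> f a b = f b a"
    and ge: "\<And>t g. (\<And>a. a \<in> S \<Longrightarrow> (\<Sum>b\<in>S. f a b * g b) = t * g a) \<Longrightarrow> (\<Sum>a\<in>S. (g a)\<^sup>2) > 0 \<Longrightarrow> c \<le> t"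
  shows "c \<le> smallest_eigenvalue (matrix_on S f)"
proof -
  let ?n = "card S"
  obtain d w where d: "eigenvalues_mset (matrix_on S f) = image_mset d (mset_set {..<?n})"
    and ort': "\<And>i j. i < ?n \<Longrightarrow> j < ?n \<Longrightarrow> (\<Sum>a\<in>S. w i a * w j a) = (if i = j then 1 else 0)"
    and ort: "\<And>a b. a \<in> S \<Longrightarrow> b \<in> S \<Longrightarrow> (\<Sum>i<?n. w i a * w i b) = (if a = b then 1 else 0)"
    and f: "\<And>a b. a \<in> S \<Longrightarrow> b \<in> S \<Longrightarrow> f a b = (\<Sum>i<?n. d i * (w i a * w i b))"
    by (rule matrix_on_spectral_decomposition[of S f, OF S(1) sym], assumption, assumption) (rule that)
  have "c \<le> d j" if j: "j < ?n" for j
  proof (rule ge)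
    show "(\<Sum>a\<in>S. (w j a)\<^sup>2) > 0" using ort'[OF j j] by (simp add: power2_eq_square)
    fix a assume a: "a \<in> S"
    have "(\<Sum>b\<in>S. f a b * w j b) = (\<Sum>b\<in>S. \<Sum>i<?n. d i * w i a * (w i b * w j b))"
      using a by (intro sum.cong refl) (simp add: f sum_distrib_left sum_distrib_right algebra_simps)
    also have "\<dots> = (\<Sum>i<?n. d i * w i a * (\<Sum>b\<in>S. w i b * w j b))"
      by (subst sum.swap) (simp add: sum_distrib_left)
    also have "\<dots> = (\<Sum>i<?n. if i = j then d i * w i a else 0)"
      using j by (intro sum.cong) (auto simp: ort')
    finally show "(\<Sum>b\<in>S. f a b * w j b) = d j * w j a" using j by simp
  qed
  moreover have "{..<?n} \<noteq> {}" using S by (metis card_eq_0_iff lessThan_iff empty_iff neq0_conv)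
  ultimately show ?thesis unfolding smallest_eigenvalue_def d by (subst Min_ge_iff) auto
qed

section \<open>The local graph\<close>

text \<open>The plane argument in abstract form: \<open>f\<close> stands for the distance matrix and
  \<open>N\<close> for the neighbours of \<open>x\<close>. A plane on which the form is positive
  definite would meet the hyperplane given by \<open>u\<close> in a nonzero vector, against
  \<open>nonpos\<close>.\<close>

lemma quadratic_form_nonpos_of_hyperplane:
  assumes S: "finite S" and NS: "N \<subseteq> S" and xS: "x \<in> S" and xN: "x \<notin> N" and N0: "N \<noteq> {}"
    and sym: "\<And>a b. a \<in> S \<Longrightarrow> b \<in> S \<Longrightarrow> f a b = f b a"
    and fxx: "f x x = 0" and fx: "\<And>b. b \<in> N \<Longrightarrow> f x b = 1"
    and nonpos: "\<And>g. (\<Sum>a\<in>S. u a * g a) = 0 \<Longrightarrow> quadratic_form S f g \<le> 0"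
    and v: "(\<Sum>a\<in>N. v a) = 0"
  shows "quadratic_form N f v \<le> 0"
proof (rule ccontr)
  assume "\<not> ?thesis"
  hence V: "quadratic_form N f v > 0" by simp
  have N: "finite N" using NS S finite_subset by blast
  define B where "B g h = (\<Sum>a\<in>S. \<Sum>b\<in>S. g a * f a b * h b)" for g h
  have B_sym: "B g h = B h g" for g h
    unfolding B_def by (subst sum.swap, intro sum.cong refl) (simp add: sym mult.commute mult.left_commute)
  have B_lin: "B (\<lambda>a. p * g a + r * g' a) h = p * B g h + r * B g' h" for p r g g' h
    unfolding B_def by (simp add: algebra_simps sum.distrib sum_distrib_left)
  have B_lin': "B h (\<lambda>a. p * g a + r * g' a) = p * B h g + r * B h g'" for p r g g' h
    by (simp add: B_sym[of h] B_lin)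
  define one where "one a = (if a \<in> N then 1 else 0 :: real)" for a
  define e where "e a = (if a = x then 1 else 0 :: real)" for a
  define w where "w a = (if a \<in> N then v a else 0 :: real)" for a
  have sum_N: "(\<Sum>a\<in>S. if a \<in> N then h a else 0) = sum h N" for h :: "'a \<Rightarrow> real"
    using sum.inter_restrict[OF S, of h N] NS by (simp add: Int_absorb1)
  have B_e: "B e h = (\<Sum>b\<in>S. f x b * h b)" for h
  proof -
    have "B e h = (\<Sum>a\<in>S. if a = x then (\<Sum>b\<in>S. f x b * h b) else 0)"
      unfolding B_def e_def by (intro sum.cong) auto
    thus ?thesis using S xS by simp
  qed
  have Bee: "B e e = 0"
  proof -
    have "B e e = (\<Sum>b\<in>S. if b = x then f x x else 0)"
      unfolding B_e by (intro sum.cong) (auto simp: e_def)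
    thus ?thesis using S xS fxx by simp
  qed
  have Be1: "B e one = card N"
  proof -
    have "B e one = (\<Sum>b\<in>S. if b \<in> N then 1 else 0)"
      unfolding B_e by (intro sum.cong) (auto simp: one_def fx)
    thus ?thesis by (simp add: sum_N)
  qed
  \<comment> \<open>The row of \<open>x\<close> is constant on \<open>N\<close>, so the condition
    that \<open>v\<close> sums to 0 makes \<open>e\<close> and \<open>w\<close> orthogonal for the
    form. Hence adding multiples of \<open>e\<close> to \<open>one\<close> changes neither
    \<open>b\<close> nor the value at \<open>w\<close>.\<close>
  have Bew: "B e w = 0"
  proof -
    have "B e w = (\<Sum>b\<in>S. if b \<in> N then v b else 0)"
      unfolding B_e by (intro sum.cong) (auto simp: w_def fx)
    thus ?thesis by (simp add: sum_N v)
  qed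
  have Bww: "B w w = quadratic_form N f v"
  proof -
    have "B w w = (\<Sum>a\<in>S. if a \<in> N then (\<Sum>b\<in>S. if b \<in> N then v a * f a b * v b else 0) else 0)"
      unfolding B_def w_def by (intro sum.cong) (auto intro!: sum.cong)
    thus ?thesis unfolding quadratic_form_def sum_N .
  qed
  \<comment> \<open>Here \<open>q\<close> is the value of the form at \<open>w\<close>, not the
    parameter of the distance matrix.\<close>
  define q where "q = B w w"
  have q: "q > 0" using V unfolding q_def Bww .
  have k: "real (card N) > 0" using N N0 by (simp add: card_gt_0_iff)
  define b where "b = B w one"
  \<comment> \<open>With this \<open>t\<close> the form has determinant \<open>q\<close> on the plane spanned by \<open>w\<close> and \<open>t e + one\<close>.\<close>
  define t where "t = (b\<^sup>2 / q + 1 - B one one) / (2 * card N)"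
  define h where "h a = t * e a + 1 * one a" for a
  have Bwh: "B w h = b" unfolding h_def B_lin' by (simp add: B_sym[of w e] Bew b_def)
  have "B h h = 2 * card N * t + B one one"
    unfolding h_def B_lin' unfolding B_lin by (simp add: B_sym[of one e] Bee Be1)
  hence Bhh: "B h h = b\<^sup>2 / q + 1" using k unfolding t_def by simp
  define U where "U g = (\<Sum>a\<in>S. u a * g a)" for g
  obtain p r where pr: "p * U w + r * U h = 0" "p \<noteq> 0 \<or> r \<noteq> 0"
  proof (cases "U h = 0")
    case True
    thus ?thesis using that[of 0 1] by simp
  next
    case False
    thus ?thesis using that[of "U h" "- U w"] by simp
  qed
  define g where "g a = p * w a + r * h a" for a
  have "U g = 0" using pr(1) unfolding U_def g_def
    by (simp add: algebra_simps sum.distrib sum_distrib_left)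
  hence "B g g \<le> 0" using nonpos[of g] unfolding U_def B_def quadratic_form_def by simp
  moreover have "B g g = q * p\<^sup>2 + 2 * p * r * b + r\<^sup>2 * (b\<^sup>2 / q + 1)"
    unfolding g_def B_lin' unfolding B_lin
    by (simp add: B_sym[of h w] Bwh Bhh q_def[symmetric] power2_eq_square algebra_simps)
  \<comment> \<open>Completing the square shows that the form is positive definite in the
    coefficients \<open>p\<close> and \<open>r\<close>.\<close>
  moreover have "\<dots> = q * (p + r * b / q)\<^sup>2 + r\<^sup>2"
    using q by (simp add: power2_eq_square field_simps)
  ultimately have "q * (p + r * b / q)\<^sup>2 + r\<^sup>2 \<le> 0" by simp
  moreover have "q * (p + r * b / q)\<^sup>2 \<ge> 0" "r\<^sup>2 \<ge> 0" using q by simp_all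
  ultimately have "q * (p + r * b / q)\<^sup>2 = 0" "r\<^sup>2 = 0" by linarith+
  thus False using q pr(2) by simp
qed

section \<open>Distances 1 and 2, and neighbourhoods\<close>

lemma (in sym_digraph) awalk_reverse:
  assumes "awalk u p v"
  shows "\<exists>p'. awalk v p' u \<and> length p' = length p"
  using assms
proof (induction p arbitrary: u)
  case Nil
  thus ?case by (auto simp: awalk_Nil_iff)
next
  case (Cons e p)
  hence e: "e \<in> arcs G" "u = tail G e" "awalk (head G e) p v" by (auto simp: awalk_Cons_iff)
  obtain p' where p': "awalk v p' (head G e)" "length p' = length p" using Cons.IH e(3) by blast
  obtain e' where "e' \<in> arcs G" "tail G e = head G e'" "head G e = tail G e'"
    using sym_arcs e(1) unfolding symmetric_conv by blast
  hence "awalk v (p' @ [e']) u"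
    using p' arc_implies_awalk[of e'] e(2) by (intro awalk_appendI) auto
  thus ?case using p' by (intro exI[of _ "p' @ [e']"]) simp
qed

lemma (in sym_digraph) vertex_dist_commute: "vertex_dist G u v = vertex_dist G v u"
proof -
  have "(\<exists>p. awalk u p v \<and> length p = n) = (\<exists>p. awalk v p u \<and> length p = n)" for n
    using awalk_reverse[of u _ v] awalk_reverse[of v _ u] by blast
  thus ?thesis unfolding vertex_dist_def by simp
qed

lemma (in wf_digraph) vertex_dist_adjacent:
  assumes "u \<rightarrow>\<^bsub>G\<^esub> v" "u \<noteq> v"
  shows "vertex_dist G u v = 1"
  unfolding vertex_dist_def
proof (rule Least_equality)
  obtain e where "e \<in> arcs G" "tail G e = u" "head G e = v" using assms(1) by (rule reachableE)
  thus "\<exists>p. awalk u p v \<and> length p = 1" using arc_implies_awalk by (intro exI[of _ "[e]"]) auto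
  fix n assume "\<exists>p. awalk u p v \<and> length p = n"
  thus "1 \<le> n" using assms(2) by (cases n) (auto simp: awalk_Nil_iff)
qed

lemma (in wf_digraph) awalk_length_1D:
  assumes "awalk u p v" "length p = 1"
  shows "u \<rightarrow>\<^bsub>G\<^esub> v"
proof -
  obtain e where "p = [e]" using assms(2) by (cases p) auto
  thus ?thesis using assms(1) by (auto simp: awalk_simps arcs_ends_conv)
qed

text \<open>The walk through \<open>x\<close> has length 2, and shorter walks would make
  \<open>u\<close> and \<open>v\<close> equal or adjacent. Thus distinct neighbours of a vertex are
  only ever at distance 1 or 2.\<close>

lemma (in wf_digraph) vertex_dist_common_neighbour:
  assumes "u \<rightarrow>\<^bsub>G\<^esub> x" "x \<rightarrow>\<^bsub>G\<^esub> v" "u \<noteq> v" "\<not> u \<rightarrow>\<^bsub>G\<^esub> v"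
  shows "vertex_dist G u v = 2"
  unfolding vertex_dist_def
proof (rule Least_equality)
  obtain e e' where "e \<in> arcs G" "tail G e = u" "head G e = x" "e' \<in> arcs G" "tail G e' = x" "head G e' = v"
    using assms(1,2) by (auto elim!: reachableE)
  thus "\<exists>p. awalk u p v \<and> length p = 2" by (intro exI[of _ "[e, e']"]) (auto simp: awalk_simps)
  fix n assume "\<exists>p. awalk u p v \<and> length p = n"
  then obtain p where p: "awalk u p v" "length p = n" by blast
  have "n \<noteq> 0" using p assms(3) by (auto simp: awalk_Nil_iff)
  moreover have "n \<noteq> 1" using p assms(4) awalk_length_1D by blast
  ultimately show "2 \<le> n" by linarith
qed

text \<open>Reachability guarantees that the \<open>LEAST\<close> in \<open>vertex_dist\<close> is
  attained by a walk.\<close>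

lemma (in wf_digraph) vertex_dist_1D:
  assumes "u \<rightarrow>\<^sup>* v" "vertex_dist G u v = 1"
  shows "u \<rightarrow>\<^bsub>G\<^esub> v"
proof -
  obtain p where "awalk u p v" using assms(1) reachable_awalk by blast
  hence "\<exists>n p. awalk u p v \<and> length p = n" by blast
  from LeastI_ex[OF this] have "\<exists>p. awalk u p v \<and> length p = vertex_dist G u v"
    unfolding vertex_dist_def .
  thus ?thesis using assms(2) awalk_length_1D by auto
qed

lemma (in nomulti_digraph) card_out_neighbours: "card {y. x \<rightarrow>\<^bsub>G\<^esub> y} = out_degree G x"
proof -
  have "inj_on (head G) (out_arcs G x)"
    by (rule inj_onI) (auto intro!: no_multi_arcs simp: arc_to_ends_def)
  moreover have "{y. x \<rightarrow>\<^bsub>G\<^esub> y} = head G ` out_arcs G x" by (auto simp: arcs_ends_conv)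
  ultimately show ?thesis unfolding out_degree_def by (simp add: card_image)
qed

lemma matrix_on_cong:
  assumes "finite S" "\<And>a b. a \<in> S \<Longrightarrow> b \<in> S \<Longrightarrow> f a b = g a b"
  shows "matrix_on S f = matrix_on S g"
proof -
  define vs where "vs = (SOME vs. distinct vs \<and> set vs = S)"
  note vs = some_enumeration[OF assms(1), folded vs_def]
  have "vs ! i \<in> S" if "i < card S" for i 
    using that distinct_card[OF vs(1)] nth_mem[of i vs] vs(2) by simp
  thus ?thesis unfolding matrix_on_def vs_def[symmetric] Let_def
    by (intro eq_matI) (auto intro: assms(2))
qed

lemma adjacency_matrix_local_graph:
  assumes "finite {y. x \<rightarrow>\<^bsub>G\<^esub> y}"
  shows "adjacency_matrix (local_graph G x)
    = matrix_on {y. x \<rightarrow>\<^bsub>G\<^esub> y} (\<lambda>u v. if u \<rightarrow>\<^bsub>G\<^esub> v then 1 else 0)"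
proof -
  have "arcs_ends (G \<restriction> N) = arcs_ends G \<inter> N \<times> N" for N
    by (auto simp: arcs_ends_conv)
  thus ?thesis unfolding adjacency_matrix_def local_graph_def induce_subgraph_verts
    by (intro matrix_on_cong[OF assms]) simp
qed

text \<open>In a connected graph adjacency means distance 1, so the degree of \<open>y\<close> in
  the local graph is the intersection number \<open>p 1 1 1\<close>, the same for all neighbours
  \<open>y\<close>.\<close>

lemma distance_regular_local_graph_regular:
  assumes dr: "distance_regular G" and x: "x \<in> verts G"
  shows "\<exists>r. \<forall>y. x \<rightarrow>\<^bsub>G\<^esub> y \<longrightarrow> card {z. x \<rightarrow>\<^bsub>G\<^esub> z \<and> y \<rightarrow>\<^bsub>G\<^esub> z} = r"
proof -
  from dr have "graph G" and conn: "Digraph_Component.connected G" unfolding distance_regular_def by auto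
  then interpret graph G by simp
  have reach: "u \<rightarrow>\<^sup>*\<^bsub>G\<^esub> v" if "u \<in> verts G" "v \<in> verts G" for u v
    using symmetric_connected_imp_strongly_connected[OF sym_arcs conn] that by auto
  from dr obtain p where p: "\<And>x y i j. x \<in> verts G \<Longrightarrow> y \<in> verts G \<Longrightarrow>
      card {z \<in> verts G. vertex_dist G x z = i \<and> vertex_dist G y z = j} = p (vertex_dist G x y) i j"
    unfolding distance_regular_def by blast
  have adj: "vertex_dist G u v = 1 \<longleftrightarrow> u \<rightarrow>\<^bsub>G\<^esub> v" if "u \<in> verts G" "v \<in> verts G" for u v
    using vertex_dist_1D[OF reach[OF that]] vertex_dist_adjacent adj_not_same by blast
  show ?thesis
  proof (intro exI allI impI)
    fix y assume y: "x \<rightarrow>\<^bsub>G\<^esub> y"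
    hence yv: "y \<in> verts G" using adj_in_verts by blast
    have "{z. x \<rightarrow>\<^bsub>G\<^esub> z \<and> y \<rightarrow>\<^bsub>G\<^esub> z} = {z \<in> verts G. vertex_dist G x z = 1 \<and> vertex_dist G y z = 1}"
      using adj x yv adj_in_verts by blast
    thus "card {z. x \<rightarrow>\<^bsub>G\<^esub> z \<and> y \<rightarrow>\<^bsub>G\<^esub> z} = p 1 1 1"
      using p[OF x yv, of 1 1] adj[OF x yv] y by simp
  qed
qed

text \<open>Evaluating the distance matrix on the neighbours of \<open>x\<close> gives a combination
  of \<open>J\<close>, \<open>I\<close> and the local adjacency matrix. The factor
  \<open>1 / q\<close> stays in place, so that one inequality serves both signs of
  \<open>q\<close>.\<close>

lemma q_distance_local_quadratic_form_nonpos: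
  assumes "graph G" and q: "q \<noteq> 0" and x: "x \<in> verts G"
    and one: "exactly_one_positive_eigenvalue (q_distance_matrix G q)"
    and v: "(\<Sum>a | x \<rightarrow>\<^bsub>G\<^esub> a. v a) = 0"
  shows "(1 / q) * quadratic_form {y. x \<rightarrow>\<^bsub>G\<^esub> y} (\<lambda>a b. if a \<rightarrow>\<^bsub>G\<^esub> b then 1 else 0) v
    \<ge> - (1 + 1 / q) * (\<Sum>a | x \<rightarrow>\<^bsub>G\<^esub> a. (v a)\<^sup>2)"
proof -
  interpret graph G by fact
  let ?N = "{y. x \<rightarrow>\<^bsub>G\<^esub> y}"
  let ?A = "\<lambda>a b. if a \<rightarrow>\<^bsub>G\<^esub> b then 1 else 0 :: real"
  let ?I = "\<lambda>a b. if a = b then 1 else 0 :: real"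
  have NS: "?N \<subseteq> verts G" using adj_in_verts by blast
  have N: "finite ?N" using NS finite_verts finite_subset by blast
  have xN: "x \<notin> ?N" using adj_not_same by auto
  have adj_sym: "a \<rightarrow>\<^bsub>G\<^esub> b \<Longrightarrow> b \<rightarrow>\<^bsub>G\<^esub> a" for a b using arcs_ends_symmetric[OF sym_arcs] .
  define f where "f u v = (if u = v then 0 else (\<Sum>i < vertex_dist G u v. 1 / q ^ i))" for u v
  have symf: "f a b = f b a" for a b unfolding f_def by (simp add: vertex_dist_commute)
  have "size {#t \<in># eigenvalues_mset (matrix_on (verts G) f). t > 0#} \<le> 1"
    using one unfolding exactly_one_positive_eigenvalue_def q_distance_matrix_def f_def by simp
  from at_most_one_large_eigenvalue_imp_bound_on_hyperplane[OF finite_verts symf this]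
  obtain u where u: "\<And>g. (\<Sum>a\<in>verts G. u a * g a) = 0 \<Longrightarrow> quadratic_form (verts G) f g \<le> 0"
    by auto
  have fx: "f x b = 1" if "b \<in> ?N" for b
    using vertex_dist_adjacent[of x b] that xN unfolding f_def by auto
  have nonpos: "quadratic_form ?N f v \<le> 0"
  proof (cases "?N = {}")
    case False
    show ?thesis
      by (rule quadratic_form_nonpos_of_hyperplane[OF finite_verts NS x xN False symf _ fx u v])
        (auto simp: f_def)
  qed (simp add: quadratic_form_def)
  \<comment> \<open>Distances 0, 1 and 2 give the entries 0, 1 and \<open>1 + 1 / q\<close>.\<close>
  have f_eq: "f a b = (1 + 1 / q) * (1 - ?I a b) - 1 / q * ?A a b" if ab: "a \<in> ?N" "b \<in> ?N" for a b
  proof -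
    consider "a = b" | "a \<noteq> b" "a \<rightarrow>\<^bsub>G\<^esub> b" | "a \<noteq> b" "\<not> a \<rightarrow>\<^bsub>G\<^esub> b" by blast
    thus ?thesis
    proof cases
      case 1
      thus ?thesis using adj_not_same unfolding f_def by auto
    next
      case 2
      thus ?thesis using vertex_dist_adjacent[of a b] unfolding f_def by simp
    next
      case 3
      have "vertex_dist G a b = 2"
        using ab 3 adj_sym by (intro vertex_dist_common_neighbour[of a x b]) auto
      thus ?thesis using 3 unfolding f_def by (simp add: numeral_2_eq_2)
    qed
  qed
  have "quadratic_form ?N f v = (\<Sum>a\<in>?N. \<Sum>b\<in>?N. (1 + 1 / q) * (v a * v b)
      - (1 + 1 / q) * (v a * ?I a b * v b) - 1 / q * (v a * ?A a b * v b))"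
    unfolding quadratic_form_def by (intro sum.cong refl) (simp add: f_eq algebra_simps)
  \<comment> \<open>The product of the two sums is the contribution of \<open>J\<close>; it vanishes
    because \<open>v\<close> sums to 0.\<close>
  also have "\<dots> = (1 + 1 / q) * ((\<Sum>a\<in>?N. v a) * (\<Sum>b\<in>?N. v b))
      - (1 + 1 / q) * quadratic_form ?N ?I v - 1 / q * quadratic_form ?N ?A v"
    unfolding quadratic_form_def sum_product
    by (simp only: sum_subtractf sum_distrib_left)
  also have "\<dots> = - (1 + 1 / q) * (\<Sum>a\<in>?N. (v a)\<^sup>2) - 1 / q * quadratic_form ?N ?A v"
    unfolding quadratic_form_identity[OF N] v by (simp add: algebra_simps)
  finally show ?thesis using nonpos by linarith
qed

theorem theorem5p2:
  fixes G :: "('a, 'b) pre_digraph" and x :: 'a and D k :: nat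
  assumes "distance_regular G"
    and "graph_diameter G = D" and "D \<ge> 2"
    and "\<forall>v \<in> verts G. out_degree G v = k" and "k \<ge> 2"
    and "x \<in> verts G"
  shows "(\<forall>q > 0. exactly_one_positive_eigenvalue (q_distance_matrix G q) \<longrightarrow>
            smallest_eigenvalue (adjacency_matrix (local_graph G x)) \<ge> - q - 1)
       \<and> (\<forall>q < 0. exactly_one_positive_eigenvalue (q_distance_matrix G q) \<longrightarrow>
            second_largest_eigenvalue (adjacency_matrix (local_graph G x)) \<le> - q - 1)"
proof -
  have G: "graph G" using assms(1) unfolding distance_regular_def by simp
  then interpret graph G .
  let ?N = "{y. x \<rightarrow>\<^bsub>G\<^esub> y}"
  let ?A = "\<lambda>a b. if a \<rightarrow>\<^bsub>G\<^esub> b then 1 else 0 :: real"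
  have "?N \<subseteq> verts G" using adj_in_verts by blast
  hence N: "finite ?N" using finite_verts finite_subset by blast
  \<comment> \<open>Two neighbours ensure that a second largest eigenvalue of the local graph
    exists.\<close>
  have card: "card ?N \<ge> 2" using card_out_neighbours[of x] assms(4-6) by simp
  hence N0: "?N \<noteq> {}" by (metis card.empty not_numeral_le_zero)
  have adj_sym: "a \<rightarrow>\<^bsub>G\<^esub> b \<longleftrightarrow> b \<rightarrow>\<^bsub>G\<^esub> a" for a b
    using arcs_ends_symmetric[OF sym_arcs, of a b] arcs_ends_symmetric[OF sym_arcs, of b a] by (rule iffI)
  hence symA: "?A a b = ?A b a" for a b by (rule if_cong) simp_all
  note bound = q_distance_local_quadratic_form_nonpos[OF G _ assms(6)]
  from distance_regular_local_graph_regular[OF assms(1,6)]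
  obtain r where r: "\<forall>y. x \<rightarrow>\<^bsub>G\<^esub> y \<longrightarrow> card {z. x \<rightarrow>\<^bsub>G\<^esub> z \<and> y \<rightarrow>\<^bsub>G\<^esub> z} = r" ..
  show ?thesis unfolding adjacency_matrix_local_graph[OF N]
  proof (intro conjI allI impI)
    fix q :: real
    assume q: "q > 0" and one: "exactly_one_positive_eigenvalue (q_distance_matrix G q)"
    show "- q - 1 \<le> smallest_eigenvalue (matrix_on ?N ?A)"
    proof (rule smallest_eigenvalue_geI[OF N N0 symA])
      fix t g assume eig: "\<And>a. a \<in> ?N \<Longrightarrow> (\<Sum>b\<in>?N. ?A a b * g b) = t * g a"
        and pos: "(\<Sum>a\<in>?N. (g a)\<^sup>2) > 0"
      \<comment> \<open>Pairing the eigenvector with the all-ones vector, itself an eigenvector for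
        the local valency \<open>r\<close>, shows that \<open>t = r\<close> unless \<open>g\<close>
        sums to 0.\<close>
      have "t * (\<Sum>a\<in>?N. g a) = (\<Sum>a\<in>?N. \<Sum>b\<in>?N. ?A a b * g b)"
        unfolding sum_distrib_left by (intro sum.cong refl eig[symmetric])
      also have "\<dots> = (\<Sum>b\<in>?N. (\<Sum>a\<in>?N. ?A b a) * g b)"
        unfolding sum_distrib_right by (subst sum.swap, intro sum.cong refl arg_cong2[of _ _ _ _ "(*)"] symA)
      also have "\<dots> = (\<Sum>b\<in>?N. r * g b)"
      proof (intro sum.cong refl)
        fix b assume b: "b \<in> ?N"
        have "(\<Sum>a\<in>?N. ?A b a) = card (?N \<inter> {a. b \<rightarrow>\<^bsub>G\<^esub> a})"
          using N by (simp add: sum.If_cases)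
        also have "?N \<inter> {a. b \<rightarrow>\<^bsub>G\<^esub> a} = {z. x \<rightarrow>\<^bsub>G\<^esub> z \<and> b \<rightarrow>\<^bsub>G\<^esub> z}" by auto
        finally show "(\<Sum>a\<in>?N. ?A b a) * g b = r * g b" using r b by simp
      qed
      finally have "t * (\<Sum>a\<in>?N. g a) = r * (\<Sum>a\<in>?N. g a)" by (simp add: sum_distrib_left)
      \<comment> \<open>If \<open>t = r\<close>, then \<open>t\<close> is a cardinality and so
        nonnegative, while \<open>- q - 1\<close> is negative. Otherwise the bound on vectors
        summing to 0 applies to \<open>g\<close>.\<close>
      then consider "t = r" | "(\<Sum>a\<in>?N. g a) = 0" by auto
      thus "- q - 1 \<le> t"
      proof cases
        case 2
        have "quadratic_form ?N ?A g = (\<Sum>a\<in>?N. g a * (\<Sum>b\<in>?N. ?A a b * g b))"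
          unfolding quadratic_form_def by (simp only: sum_distrib_left mult.assoc)
        also have "\<dots> = t * (\<Sum>a\<in>?N. (g a)\<^sup>2)"
          unfolding sum_distrib_left[of t]
          by (intro sum.cong refl) (subst eig, auto simp: power2_eq_square)
        finally have "- (1 + 1 / q) * (\<Sum>a\<in>?N. (g a)\<^sup>2) \<le> 1 / q * (t * (\<Sum>a\<in>?N. (g a)\<^sup>2))"
          using bound[OF _ one 2] q by simp
        hence "- (1 + 1 / q) * (\<Sum>a\<in>?N. (g a)\<^sup>2) \<le> (t / q) * (\<Sum>a\<in>?N. (g a)\<^sup>2)" by simp
        hence "- (1 + 1 / q) \<le> t / q" using pos by (rule mult_right_le_imp_le)
        from mult_left_mono[OF this, of q] show ?thesis using q by (simp add: algebra_simps)
      qed (use q in simp)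
    qed
  next
    fix q :: real
    assume q: "q < 0" and one: "exactly_one_positive_eigenvalue (q_distance_matrix G q)"
    show "second_largest_eigenvalue (matrix_on ?N ?A) \<le> - q - 1"
    proof (rule bound_on_hyperplane_imp_second_largest_eigenvalue_le[OF N symA card])
      fix g :: "'a \<Rightarrow> real"
      \<comment> \<open>The hyperplane is the orthogonal complement of the all-ones vector:
        \<open>u\<close> is the constant 1.\<close>
      assume "(\<Sum>a\<in>?N. 1 * g a) = 0"
      hence "- (1 + 1 / q) * (\<Sum>a\<in>?N. (g a)\<^sup>2) \<le> 1 / q * quadratic_form ?N ?A g"
        using bound[OF _ one, of g] q by simp
      \<comment> \<open>Multiplying by the negative \<open>q\<close> reverses the inequality, which
        is why this case bounds eigenvalues from above.\<close>
      from mult_left_mono_neg[OF this, of q]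
      have "q * (1 / q * quadratic_form ?N ?A g) \<le> q * (- (1 + 1 / q) * (\<Sum>a\<in>?N. (g a)\<^sup>2))"
        using q by simp
      moreover have "q * (1 / q * X) = X" "q * (- (1 + 1 / q) * Y) = (- q - 1) * Y" for X Y
        using q by (simp_all add: algebra_simps)
      ultimately show "quadratic_form ?N ?A g \<le> (- q - 1) * (\<Sum>a\<in>?N. (g a)\<^sup>2)"
        by (simp only:)
    qed
  qed
qed

end
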